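(* Let $G$ be a finite simple graph that is $\delta$-dense, and suppose that $G$ and $G^2$ have nested solutions. Label $V_G=\{0,1,\dots,|V_G|-1\}$ according to an optimal order of $G$. Let $\mathcal{O}$ be a compressed optimal order on $G^2$ (with respect to this labeling). Then $\mathcal{O}$ is the lexicographic order $\mathcal{L}$ or the colexicographic order $\mathcal{C}$ on $V_G\times V_G$.
   Context: All graphs are finite and simple. For a graph $G=(V,E)$ and $A\subseteq V$, let $I_G(A)$ be the set of edges of $G$ with both endpoints in $A$, and for $0\le m\le |V|$ let $I_G(m)=\max_{A\subseteq V,\,|A|=m}|I_G(A)|$. A set $A$ with $|A|=m$ and $|I_G(A)|=I_G(m)$ is called optimal. $G$ has nested solutions (NS) if there are sets $A_1\subseteq\cdots\subseteq A_{|V|}$ with $|A_i|=i$ and each $A_i$ optimal; the resulting total order on $V$ (in which the vertex of $A_i\setminus A_{i-1}$ is the $i$-th vertex) is called an optimal order, and labeling the vertices $0,1,\dots,|V|-1$ in this order makes every initial segment $\{0,\dots,k-1\}$ optimal. The $\delta$-sequence of $G$ is $\delta_G(m)=I_G(m)-I_G(m-1)$, $1\le m\le |V|$. Partition $\delta_G$ into consecutive maximal strictly increasing runs ("monotonic segments"); let $r$ be their number and $s_{G,i}$ the first value of the $i$-th run. $G$ is $\delta$-dense iff $s_{G,2},\dots,s_{G,r}>1$. $G^2=G\square G$ has vertex set $V_G\times V_G$, with $(x,y)\sim(u,v)$ iff ($x=u$ and $\{y,v\}\in E_G$) or ($\{x,u\}\in E_G$ and $y=v$). A set $A\subseteq V_G\times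 V_G$ is compressed if for every $a$, the sets $\{y:(a,y)\in A\}$ and $\{x:(x,a)\in A\}$ are each of the form $\{0,1,\dots,k-1\}$ for some $k\ge 0$. A compressed optimal order on $G^2$ is a total order on $V_G\times V_G$ such that every initial segment is both compressed and optimal in $G^2$. The lexicographic order: $(x_1,x_2)<_{\mathcal{L}}(y_1,y_2)$ iff $x_1<y_1$, or $x_1=y_1$ and $x_2<y_2$. The colexicographic order: $(x_1,x_2)<_{\mathcal{C}}(y_1,y_2)$ iff $x_2<y_2$, or $x_2=y_2$ and $x_1<y_1$. *)

theory Defs
  imports Main
begin

definition simple_graph :: "'a set \<Rightarrow> 'a set set \<Rightarrow> bool" where
  "simple_graph V E \<longleftrightarrow> finite V \<and> E \<subseteq> {{u, v} |u v. u \<in> V \<and> v \<in> V \<and> u \<noteq> v}"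

definition induced_edges :: "'a set set \<Rightarrow> 'a set \<Rightarrow> 'a set set" where
  "induced_edges E A = {e \<in> E. e \<subseteq> A}"

text \<open>Only meaningful for \<open>m \<le> card V\<close>, where the maximum is over a nonempty set.\<close>

definition max_induced :: "'a set \<Rightarrow> 'a set set \<Rightarrow> nat \<Rightarrow> nat" where
  "max_induced V E m = Max {card (induced_edges E A) |A. A \<subseteq> V \<and> card A = m}"

definition optimal_set :: "'a set \<Rightarrow> 'a set set \<Rightarrow> 'a set \<Rightarrow> bool" where
  "optimal_set V E A \<longleftrightarrow> A \<subseteq> V \<and> card (induced_edges E A) = max_induced V E (card A)"

definition nested_solutions :: "'a set \<Rightarrow> 'a set set \<Rightarrow> bool" where
  "nested_solutions V E \<longleftrightarrow>
    (\<exists>A :: nat \<Rightarrow> 'a set.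
      (\<forall>i\<in>{1..card V}. card (A i) = i \<and> optimal_set V E (A i)) \<and>
      (\<forall>i\<in>{1..<card V}. A i \<subseteq> A (Suc i)))"

definition optimal_labeling :: "'a set \<Rightarrow> 'a set set \<Rightarrow> ('a \<Rightarrow> nat) \<Rightarrow> bool" where
  "optimal_labeling V E lab \<longleftrightarrow>
    bij_betw lab V {0..<card V} \<and>
    (\<forall>k\<le>card V. optimal_set V E {v \<in> V. lab v < k})"

definition delta :: "'a set \<Rightarrow> 'a set set \<Rightarrow> nat \<Rightarrow> int" where
  "delta V E m = int (max_induced V E m) - int (max_induced V E (m - 1))"

definition delta_seq :: "'a set \<Rightarrow> 'a set set \<Rightarrow> int list" where
  "delta_seq V E = map (delta V E) [1..<card V + 1]"

text \<open>
  Decomposition of a list into its maximal strictly increasing contiguous runs; the lemmas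
  following the definition determine the result uniquely.
\<close>

fun monotonic_segments :: "'a::linorder list \<Rightarrow> 'a list list" where
  "monotonic_segments [] = []"
| "monotonic_segments [x] = [[x]]"
| "monotonic_segments (x # y # zs) =
    (let segs = monotonic_segments (y # zs)
     in if x < y then (x # hd segs) # tl segs else [x] # segs)"

lemma monotonic_segments_Cons:
  "\<exists>ys segs. monotonic_segments (x # xs) = (x # ys) # segs"
  by (induction xs arbitrary: x) (auto simp: Let_def)

lemma concat_monotonic_segments: "concat (monotonic_segments xs) = xs"
proof (induction xs rule: monotonic_segments.induct)
  case (3 x y zs)
  obtain ys segs where "monotonic_segments (y # zs) = (y # ys) # segs"
    using monotonic_segments_Cons by blast
  with 3 show ?case by (auto simp: Let_def)
qed auto

lemma monotonic_segments_increasing: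
  "s \<in> set (monotonic_segments xs) \<Longrightarrow> s \<noteq> [] \<and> sorted_wrt (<) s"
proof (induction xs arbitrary: s rule: monotonic_segments.induct)
  case (3 x y zs)
  obtain ys segs where *: "monotonic_segments (y # zs) = (y # ys) # segs"
    using monotonic_segments_Cons by blast
  have "sorted_wrt (<) (y # ys)"
    using "3.IH" * by fastforce
  moreover from this have "x < y \<Longrightarrow> \<forall>z\<in>set ys. x < z"
    by (meson less_trans sorted_wrt.simps(2))
  ultimately show ?case using 3 *
    by (auto simp: Let_def split: if_splits)
qed auto

lemma monotonic_segments_maximal:
  "Suc i < length (monotonic_segments xs) \<Longrightarrow>
    hd (monotonic_segments xs ! Suc i) \<le> last (monotonic_segments xs ! i)"
proof (induction xs arbitrary: i rule: monotonic_segments.induct)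
  case (3 x y zs)
  obtain ys segs where *: "monotonic_segments (y # zs) = (y # ys) # segs"
    using monotonic_segments_Cons by blast
  have IH: "Suc j < length ((y # ys) # segs) \<Longrightarrow>
      hd (((y # ys) # segs) ! Suc j) \<le> last (((y # ys) # segs) ! j)" for j
    using "3.IH"[of j] * by simp
  from "3.prems" * IH[of i] IH[of "i - 1"] show ?case
    by (cases i) (auto simp: Let_def split: if_splits)
qed auto

definition delta_dense :: "'a set \<Rightarrow> 'a set set \<Rightarrow> bool" where
  "delta_dense V E \<longleftrightarrow> (\<forall>s \<in> set (tl (monotonic_segments (delta_seq V E))). hd s > 1)"

definition square_edges :: "'a set \<Rightarrow> 'a set set \<Rightarrow> ('a \<times> 'a) set set" where
  "square_edges V E =
    {{(x, y), (u, v)} |x y u v.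
      x \<in> V \<and> y \<in> V \<and> u \<in> V \<and> v \<in> V \<and>
      (x = u \<and> {y, v} \<in> E \<or> {x, u} \<in> E \<and> y = v)}"

definition compressed :: "'a set \<Rightarrow> ('a \<Rightarrow> nat) \<Rightarrow> ('a \<times> 'a) set \<Rightarrow> bool" where
  "compressed V lab A \<longleftrightarrow>
    A \<subseteq> V \<times> V \<and>
    (\<forall>a\<in>V. (\<exists>k. lab ` {y. (a, y) \<in> A} = {0..<k}) \<and> (\<exists>k. lab ` {x. (x, a) \<in> A} = {0..<k}))"

text \<open>
  Total orders are reflexive relations on their carrier; their initial segments are the
  order filters \<open>ofilter\<close> (the downward closed subsets of the carrier).
\<close>

definition compressed_optimal_order ::
    "'a set \<Rightarrow> 'a set set \<Rightarrow> ('a \<Rightarrow> nat) \<Rightarrow> ('a \<times> 'a) rel \<Rightarrow> bool" where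
  "compressed_optimal_order V E lab r \<longleftrightarrow>
    linear_order_on (V \<times> V) r \<and>
    (\<forall>S. ofilter r S \<longrightarrow> compressed V lab S \<and> optimal_set (V \<times> V) (square_edges V E) S)"

fun lex_less :: "('a \<Rightarrow> nat) \<Rightarrow> 'a \<times> 'a \<Rightarrow> 'a \<times> 'a \<Rightarrow> bool" where
  "lex_less lab (x\<^sub>1, x\<^sub>2) (y\<^sub>1, y\<^sub>2) \<longleftrightarrow>
    lab x\<^sub>1 < lab y\<^sub>1 \<or> lab x\<^sub>1 = lab y\<^sub>1 \<and> lab x\<^sub>2 < lab y\<^sub>2"

fun colex_less :: "('a \<Rightarrow> nat) \<Rightarrow> 'a \<times> 'a \<Rightarrow> 'a \<times> 'a \<Rightarrow> bool" where
  "colex_less lab (x\<^sub>1, x\<^sub>2) (y\<^sub>1, y\<^sub>2) \<longleftrightarrow>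
    lab x\<^sub>2 < lab y\<^sub>2 \<or> lab x\<^sub>2 = lab y\<^sub>2 \<and> lab x\<^sub>1 < lab y\<^sub>1"

definition lex_order :: "'a set \<Rightarrow> ('a \<Rightarrow> nat) \<Rightarrow> ('a \<times> 'a) rel" where
  "lex_order V lab = {(p, q). p \<in> V \<times> V \<and> q \<in> V \<times> V \<and> (p = q \<or> lex_less lab p q)}"

definition colex_order :: "'a set \<Rightarrow> ('a \<Rightarrow> nat) \<Rightarrow> ('a \<times> 'a) rel" where
  "colex_order V lab = {(p, q). p \<in> V \<times> V \<and> q \<in> V \<times> V \<and> (p = q \<or> colex_less lab p q)}"

end

theory Submission
  imports Defs
begin

text \<open>
  Write \<open>d j = \<delta>\<^sub>G(j + 1)\<close>, the number of neighbours of vertex \<open>j\<close> among \<open>0, \<dots>, j - 1\<close>. Orienting every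
  edge of the square towards its larger endpoint shows that a compressed set \<open>S\<close> induces exactly the
  sum of \<open>d x + d y\<close> over \<open>(x, y) \<in> S\<close> edges, so the initial segments of a compressed optimal order
  are lower sets of maximal weight for their size. Density forces \<open>d j \<ge> 2\<close> for \<open>j \<ge> 2\<close>, and optimality of the
  labeling gives \<open>(\<Sum>j<m. d (c + j)) \<le> m * d c + (\<Sum>j<m. d j)\<close>, in particular \<open>d (c + 1) \<le> d c + 1\<close>.

  Up to symmetry \<open>(0, 1)\<close> precedes \<open>(1, 0)\<close>, and it remains to show that each column is completed
  before the next one is entered. Let the columns before \<open>c\<close> be complete. The set of points
  preceding \<open>(c + 1, 0)\<close> consists of these columns and the first \<open>k\<close> points of column \<open>c\<close>. If
  \<open>2 \<le> k < n\<close>, then \<open>(c, k)\<close> would be a better choice than \<open>(c + 1, 0)\<close>, because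
  \<open>d c + d k \<ge> d c + 2 > d (c + 1)\<close>. If \<open>k = 1\<close>, then the points preceding \<open>(c, 1)\<close> are the complete
  columns and \<open>j \<ge> 2\<close> points of the bottom row; together with \<open>(c, 1)\<close> they weigh less than the same
  number of points in lexicographic order.
\<close>

section \<open>Linear orders and their images\<close>

lemma Field_linear_order_on:
  assumes "linear_order_on A r"
  shows "Field r = A"
proof
  show "Field r \<subseteq> A" using assms by (auto simp: order_on_defs Field_def)
  show "A \<subseteq> Field r" using assms by (auto simp: order_on_defs dest: refl_onD intro: FieldI1)
qed

lemma mem_underS_iff_linear_order_on:
  assumes "linear_order_on A r" "p \<in> A" "q \<in> A"
  shows "q \<in> underS r p \<longleftrightarrow> (p, q) \<notin> r"
proof -
  have "(p, p) \<in> r" "p \<noteq> q \<Longrightarrow> (p, q) \<in> r \<or> (q, p) \<in> r"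
    using assms by (auto simp: order_on_defs total_on_def dest: refl_onD)
  moreover have "(p, q) \<in> r \<Longrightarrow> (q, p) \<in> r \<Longrightarrow> p = q"
    using assms(1) by (auto simp: order_on_defs dest: antisymD)
  ultimately show ?thesis by (auto simp: underS_def)
qed

lemma ofilter_under: "trans r \<Longrightarrow> ofilter r (under r p)"
  using under_Field[of r p] by (auto simp: ofilter_def under_def dest: transD)

lemma ofilter_underS: "trans r \<Longrightarrow> antisym r \<Longrightarrow> ofilter r (underS r p)"
  using Order_Relation.underS_Field[of r p]
  by (auto simp: ofilter_def under_def underS_def dest: transD antisymD)

lemma linear_order_on_eqI:
  assumes "linear_order_on A r" "s \<subseteq> r"
    and total: "\<And>p q. p \<in> A \<Longrightarrow> q \<in> A \<Longrightarrow> (p, q) \<in> s \<or> (q, p) \<in> s"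
  shows "r = s"
proof
  show "r \<subseteq> s"
  proof clarify
    fix p q assume below: "(p, q) \<in> r"
    then have "p \<in> A" "q \<in> A" using assms(1) by (auto simp: order_on_defs)
    then consider "(p, q) \<in> s" | "(q, p) \<in> s" using total by blast
    then show "(p, q) \<in> s"
    proof cases
      assume above: "(q, p) \<in> s"
      then have "p = q" using below assms(1,2) by (auto simp: order_on_defs dest: antisymD)
      then show ?thesis using above by simp
    qed
  qed
qed fact

lemma dir_imageI: "(p, q) \<in> r \<Longrightarrow> (f p, f q) \<in> dir_image r f"
  by (auto simp: dir_image_def)

lemma linear_order_on_dir_image:
  assumes "linear_order_on A r" "inj_on f A"
  shows "linear_order_on (f ` A) (dir_image r f)"
  using Linear_order_dir_image[of r f] dir_image_Field[of r f] Field_linear_order_on[OF assms(1)] assms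
  by simp

lemma ofilter_dir_imageE:
  assumes "ofilter (dir_image r f) T"
  obtains S where "ofilter r S" "T = f ` S"
proof
  show "T = f ` {p \<in> Field r. f p \<in> T}"
    using assms by (auto simp: ofilter_def dir_image_Field)
  show "ofilter r {p \<in> Field r. f p \<in> T}"
    using assms unfolding ofilter_def under_def dir_image_def by (blast intro: FieldI1)
qed

lemma dir_image_eq_iff:
  assumes "inj_on f A" "r \<subseteq> A \<times> A" "s \<subseteq> A \<times> A"
  shows "dir_image r f = dir_image s f \<longleftrightarrow> r = s"
proof -
  have image: "dir_image t f = map_prod f f ` t" for t
    by (auto simp: dir_image_def)
  show ?thesis
    using inj_on_image_eq_iff[OF map_prod_inj_on[OF assms(1,1)] assms(2,3)] by (simp add: image)
qed

lemma dir_image_swap_swap: "dir_image (dir_image r prod.swap) prod.swap = r"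
  by (force simp: dir_image_def)

lemma colex_order_eq_dir_image_swap: "colex_order V lab = dir_image (lex_order V lab) prod.swap"
  by (force simp: dir_image_def lex_order_def colex_order_def)

lemma dir_image_lex_order:
  assumes "inj_on lab V"
  shows "dir_image (lex_order V lab) (map_prod lab lab) = lex_order (lab ` V) id"
proof
  show "dir_image (lex_order V lab) (map_prod lab lab) \<subseteq> lex_order (lab ` V) id"
    by (auto simp: dir_image_def lex_order_def)
  show "lex_order (lab ` V) id \<subseteq> dir_image (lex_order V lab) (map_prod lab lab)"
  proof clarify
    fix x y x' y' assume lex: "((x, y), (x', y')) \<in> lex_order (lab ` V) id"
    then obtain a b a' b' where labels: "a \<in> V" "b \<in> V" "a' \<in> V" "b' \<in> V"
      "x = lab a" "y = lab b" "x' = lab a'" "y' = lab b'"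
      by (auto simp: lex_order_def)
    then have "((a, b), (a', b')) \<in> lex_order V lab"
      using lex inj_on_eq_iff[OF assms] by (auto simp: lex_order_def)
    from dir_imageI[OF this, of "map_prod lab lab"]
    show "((x, y), (x', y')) \<in> dir_image (lex_order V lab) (map_prod lab lab)"
      using labels by simp
  qed
qed

lemma dir_image_colex_order:
  assumes "inj_on lab V"
  shows "dir_image (colex_order V lab) (map_prod lab lab) = colex_order (lab ` V) id"
proof -
  have "dir_image (colex_order V lab) (map_prod lab lab) =
      dir_image (dir_image (lex_order V lab) (map_prod lab lab)) prod.swap"
    unfolding colex_order_eq_dir_image_swap dir_image_def by force
  then show ?thesis
    by (simp add: dir_image_lex_order assms colex_order_eq_dir_image_swap)
qed

section \<open>Weight-optimal orders of the grid\<close>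

definition lower_set :: "('a::order \<times> 'b::order) set \<Rightarrow> bool" where
  "lower_set S \<longleftrightarrow> (\<forall>x y x' y'. (x, y) \<in> S \<longrightarrow> x' \<le> x \<longrightarrow> y' \<le> y \<longrightarrow> (x', y') \<in> S)"

definition weight :: "('a \<Rightarrow> 'b::comm_monoid_add) \<Rightarrow> ('a \<times> 'a) set \<Rightarrow> 'b" where
  "weight d S = (\<Sum>(x, y)\<in>S. d x + d y)"

definition column_segment :: "nat \<Rightarrow> nat \<Rightarrow> nat \<Rightarrow> (nat \<times> nat) set" where
  "column_segment n c k = {..<c} \<times> {..<n} \<union> {c} \<times> {..<k}"

definition row_segment :: "nat \<Rightarrow> nat \<Rightarrow> nat \<Rightarrow> (nat \<times> nat) set" where
  "row_segment n c j = {..<c} \<times> {..<n} \<union> {c..<c + j} \<times> {0}"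

lemma lower_setD: "lower_set S \<Longrightarrow> (x, y) \<in> S \<Longrightarrow> x' \<le> x \<Longrightarrow> y' \<le> y \<Longrightarrow> (x', y') \<in> S"
  unfolding lower_set_def by blast

lemma lower_set_swap: "lower_set (prod.swap ` S) \<longleftrightarrow> lower_set S"
  unfolding lower_set_def pair_in_swap_image by blast

lemma weight_swap: "weight d (prod.swap ` S) = weight d S"
  unfolding weight_def by (subst sum.reindex) (auto simp: add.commute intro!: sum.cong)

lemma weight_insert:
  "finite S \<Longrightarrow> (x, y) \<notin> S \<Longrightarrow> weight d (insert (x, y) S) = d x + d y + weight d S"
  by (simp add: weight_def)

lemma weight_Un_disjoint:
  "finite S \<Longrightarrow> finite T \<Longrightarrow> S \<inter> T = {} \<Longrightarrow> weight d (S \<union> T) = weight d S + weight d T"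
  unfolding weight_def by (rule sum.union_disjoint)

lemma weight_Times:
  fixes d :: "'a \<Rightarrow> 'b::semiring_1"
  shows "weight d (A \<times> B) = of_nat (card B) * sum d A + of_nat (card A) * sum d B"
  unfolding weight_def by (simp flip: sum.cartesian_product add: sum.distrib sum_distrib_left)

lemma nat_down_closed_lessThanE:
  fixes A :: "nat set"
  assumes "A \<subseteq> {..<n}" "\<And>i j. j \<in> A \<Longrightarrow> i \<le> j \<Longrightarrow> i \<in> A"
  obtains k where "k \<le> n" "A = {..<k}"
proof
  show "A = {..<LEAST k. k \<notin> A}"
  proof (intro set_eqI iffI)
    fix i assume "i \<in> A"
    show "i \<in> {..<LEAST k. k \<notin> A}"
    proof (rule ccontr)
      assume "i \<notin> {..<LEAST k. k \<notin> A}"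
      then have "(LEAST k. k \<notin> A) \<in> A" using assms(2)[OF \<open>i \<in> A\<close>] by simp
      moreover have "(LEAST k. k \<notin> A) \<notin> A" by (rule LeastI[of _ n]) (use assms(1) in auto)
      ultimately show False by simp
    qed
  qed (use not_less_Least in auto)
  show "(LEAST k. k \<notin> A) \<le> n"
    by (rule Least_le) (use assms(1) in auto)
qed

lemma lower_set_eq_column_segmentE:
  assumes "lower_set S" "S \<subseteq> {..<n} \<times> {..<n}" "{..<c} \<times> {..<n} \<subseteq> S" "(Suc c, 0) \<notin> S"
  obtains k where "k \<le> n" "S = column_segment n c k"
proof -
  have "{y. (c, y) \<in> S} \<subseteq> {..<n}" using assms(2) by auto
  moreover have "i \<in> {y. (c, y) \<in> S}" if "j \<in> {y. (c, y) \<in> S}" "i \<le> j" for i j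
    using lower_setD[OF assms(1)] that by blast
  ultimately obtain k where column: "k \<le> n" "{y. (c, y) \<in> S} = {..<k}"
    by (rule nat_down_closed_lessThanE)
  have left: "x \<le> c" if "(x, y) \<in> S" for x y
    using lower_setD[OF assms(1) that, of "Suc c" 0] assms(4) by (auto intro: leI simp: Suc_le_eq)
  have "(x, y) \<in> S \<longleftrightarrow> (x, y) \<in> column_segment n c k" for x y
  proof (cases "x < c")
    case True
    then show ?thesis using assms(2,3) by (auto simp: column_segment_def)
  next
    case False
    then show ?thesis using left[of x y] column(2) by (auto simp: column_segment_def)
  qed
  then have "S = column_segment n c k" by (simp add: set_eq_iff)
  then show thesis using that column(1) by blast
qed

lemma lower_set_eq_row_segmentE:
  assumes "lower_set S" "S \<subseteq> {..<n} \<times> {..<n}" "{..<c} \<times> {..<n} \<subseteq> S" "(c, 1) \<notin> S" "c \<le> n"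
  obtains j where "c + j \<le> n" "S = row_segment n c j"
proof -
  have "{i. (c + i, 0) \<in> S} \<subseteq> {..<n - c}" using assms(2) by auto
  moreover have "i \<in> {i. (c + i, 0) \<in> S}" if "j \<in> {i. (c + i, 0) \<in> S}" "i \<le> j" for i j
    using lower_setD[OF assms(1), of "c + j" 0 "c + i" 0] that by simp
  ultimately obtain j where row: "j \<le> n - c" "{i. (c + i, 0) \<in> S} = {..<j}"
    by (rule nat_down_closed_lessThanE)
  have bottom: "(x, 0) \<in> S \<longleftrightarrow> x < c + j" if "c \<le> x" for x
  proof -
    have "(c + (x - c), 0) \<in> S \<longleftrightarrow> x - c < j" using row(2) by blast
    then show ?thesis using that by auto
  qed
  have above: "y = 0" if "(x, y) \<in> S" "c \<le> x" for x y
    using lower_setD[OF assms(1) that(1,2), of 1] assms(4) by force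
  have "(x, y) \<in> S \<longleftrightarrow> (x, y) \<in> row_segment n c j" for x y
  proof (cases "x < c")
    case True
    then show ?thesis using assms(2,3) by (auto simp: row_segment_def)
  next
    case False
    then show ?thesis using bottom[of x] above[of x y] by (auto simp: row_segment_def)
  qed
  then have "S = row_segment n c j" by (simp add: set_eq_iff)
  moreover have "c + j \<le> n" using row(1) assms(5) by simp
  ultimately show thesis using that by blast
qed

lemma finite_column_segment [simp]: "finite (column_segment n c k)"
  and finite_row_segment [simp]: "finite (row_segment n c j)"
  by (simp_all add: column_segment_def row_segment_def)

lemma card_column_segment: "card (column_segment n c k) = c * n + k"
  unfolding column_segment_def by (subst card_Un_disjoint) (auto simp: card_cartesian_product)

lemma card_row_segment: "card (row_segment n c j) = c * n + j"
  unfolding row_segment_def by (subst card_Un_disjoint) (auto simp: card_cartesian_product)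

lemma lower_set_column_segment: "k \<le> n \<Longrightarrow> lower_set (column_segment n c k)"
  unfolding lower_set_def column_segment_def by auto

lemma column_segment_subset: "c < n \<Longrightarrow> k \<le> n \<Longrightarrow> column_segment n c k \<subseteq> {..<n} \<times> {..<n}"
  unfolding column_segment_def by auto

lemma column_segment_Suc: "column_segment n c (Suc k) = insert (c, k) (column_segment n c k)"
  unfolding column_segment_def by auto

lemma weight_column_segment:
  fixes d :: "nat \<Rightarrow> 'b::semiring_1"
  shows "weight d (column_segment n c k) =
    weight d ({..<c} \<times> {..<n}) + (of_nat k * d c + (\<Sum>i<k. d i))"
proof -
  have "weight d (column_segment n c k) = weight d ({..<c} \<times> {..<n}) + weight d ({c} \<times> {..<k})"
    unfolding column_segment_def by (rule weight_Un_disjoint) auto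
  then show ?thesis by (simp add: weight_Times)
qed

lemma weight_row_segment:
  fixes d :: "nat \<Rightarrow> 'b::semiring_1"
  shows "weight d (row_segment n c j) =
    weight d ({..<c} \<times> {..<n}) + ((\<Sum>i<j. d (c + i)) + of_nat j * d 0)"
proof -
  have "weight d (row_segment n c j) =
      weight d ({..<c} \<times> {..<n}) + weight d ({c..<c + j} \<times> {0})"
    unfolding row_segment_def by (rule weight_Un_disjoint) auto
  moreover have "sum d {c..<c + j} = (\<Sum>i<j. d (c + i))"
    by (simp add: sum.atLeastLessThan_shift_0[of d c] atLeast0LessThan)
  ultimately show ?thesis by (simp add: weight_Times)
qed

locale dense_increments =
  fixes n :: nat and d :: "nat \<Rightarrow> int"
  assumes increment_0: "0 < n \<Longrightarrow> d 0 = 0"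
    and increment_1: "1 < n \<Longrightarrow> d 1 \<le> 1"
    and increment_ge_2: "2 \<le> j \<Longrightarrow> j < n \<Longrightarrow> 2 \<le> d j"
    and sum_increments_shift:
      "c + m \<le> n \<Longrightarrow> (\<Sum>j<m. d (c + j)) \<le> int m * d c + (\<Sum>j<m. d j)"
begin

lemma increment_Suc:
  assumes "Suc c < n"
  shows "d (Suc c) \<le> d c + 1"
proof -
  have "d c + d (Suc c) \<le> 2 * d c + (d 0 + d 1)"
    using sum_increments_shift[of c 2] assms by (simp add: numeral_2_eq_2)
  then show ?thesis using increment_0 increment_1 assms by simp
qed

text \<open>
  Against the column, the row gains at most \<open>j * d c\<close> plus the same sum \<open>\<Sum>i<j. d i\<close>, and its return to
  \<open>(c, 1)\<close> gains \<open>d c + d 1\<close> where the column gains \<open>d c + d j\<close>.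
\<close>

lemma weight_row_return_less_column:
  assumes "2 \<le> j" "j < n" "c + j \<le> n"
  shows "weight d (insert (c, 1) (row_segment n c j)) < weight d (column_segment n c (Suc j))"
proof -
  have "(c, 1) \<notin> row_segment n c j" by (simp add: row_segment_def)
  moreover have "d 0 = 0" "d 1 < d j"
    using increment_0 increment_1 increment_ge_2[of j] assms by force+
  ultimately show ?thesis
    using sum_increments_shift[OF assms(3)]
    by (simp add: weight_insert weight_row_segment weight_column_segment algebra_simps)
qed

end

locale weight_optimal_order = dense_increments +
  fixes r :: "(nat \<times> nat) rel"
  assumes linear: "linear_order_on ({..<n} \<times> {..<n}) r"
    and ofilter_lower: "ofilter r S \<Longrightarrow> lower_set S"
    and ofilter_weight_max: "ofilter r S \<Longrightarrow> T \<subseteq> {..<n} \<times> {..<n} \<Longrightarrow> lower_set T \<Longrightarrow>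
      card T = card S \<Longrightarrow> weight d T \<le> weight d S"
begin

abbreviation "grid \<equiv> {..<n} \<times> {..<n}"

lemma trans_order: "trans r" and antisym_order: "antisym r"
  using linear by (simp_all add: order_on_defs)

lemmas mem_underS_iff = mem_underS_iff_linear_order_on[OF linear]

lemma lower_set_underS: "lower_set (underS r p)"
  by (intro ofilter_lower ofilter_underS trans_order antisym_order)

lemma underS_subset: "underS r p \<subseteq> grid"
  using Order_Relation.underS_Field[of r p] by (simp add: Field_linear_order_on[OF linear])

lemma under_eq_insert_underS: "p \<in> grid \<Longrightarrow> under r p = insert p (underS r p)"
  using Refl_under_underS[of r p] linear Field_linear_order_on[OF linear]
  by (simp add: order_on_defs)

lemma componentwise_le_imp_mem:
  assumes "(x, y) \<in> grid" "x' \<le> x" "y' \<le> y"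
  shows "((x', y'), (x, y)) \<in> r"
proof -
  have "lower_set (under r (x, y))"
    by (intro ofilter_lower ofilter_under trans_order)
  then have "(x', y') \<in> under r (x, y)"
    by (rule lower_setD) (use assms in \<open>simp_all add: under_eq_insert_underS\<close>)
  then show ?thesis by (simp add: under_def)
qed

lemma underS_mono:
  assumes "(x, y) \<in> grid" "x' \<le> x" "y' \<le> y"
  shows "underS r (x', y') \<subseteq> underS r (x, y)"
  using assms by (intro underS_incr trans_order antisym_order componentwise_le_imp_mem)

lemma weight_column_segment_le:
  assumes "p \<in> grid" "card (underS r p) = c * n + k" "c < n" "k < n"
  shows "weight d (column_segment n c (Suc k)) \<le> weight d (insert p (underS r p))"
proof (rule ofilter_weight_max)
  show "ofilter r (insert p (underS r p))"
    using ofilter_under[OF trans_order, of p] under_eq_insert_underS assms(1) by simp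
  have "finite (underS r p)" using underS_subset finite_subset by blast
  then show "card (column_segment n c (Suc k)) = card (insert p (underS r p))"
    by (simp add: underS_notIn card_column_segment assms(2))
  show "column_segment n c (Suc k) \<subseteq> grid" "lower_set (column_segment n c (Suc k))"
    using assms(3,4) by (simp_all add: column_segment_subset lower_set_column_segment)
qed

lemma second_before_next_column:
  assumes "0 < c" "Suc c < n" and columns: "{..<c} \<times> {..<n} \<subseteq> underS r (c, 0)"
  shows "((c, 1), (Suc c, 0)) \<in> r"
proof (rule ccontr)
  let ?S = "underS r (c, 1)"
  assume "((c, 1), (Suc c, 0)) \<notin> r"
  then have next_mem: "(Suc c, 0) \<in> ?S"
    using mem_underS_iff[of "(c, 1)" "(Suc c, 0)"] assms(1,2) by simp
  have "underS r (c, 0) \<subseteq> ?S"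
    using assms(1,2) by (intro underS_mono) auto
  then have "{..<c} \<times> {..<n} \<subseteq> ?S" using columns by blast
  then obtain j where j_le: "c + j \<le> n" and S: "?S = row_segment n c j"
    using lower_set_eq_row_segmentE[OF lower_set_underS underS_subset] assms(2) underS_notIn
    by (metis Suc_lessD less_imp_le)
  have "2 \<le> j" using next_mem unfolding S by (simp add: row_segment_def)
  have "j < n" using j_le assms(1) by simp
  have "weight d (column_segment n c (Suc j)) \<le> weight d (insert (c, 1) ?S)"
  proof (rule weight_column_segment_le)
    show "card ?S = c * n + j" unfolding S by (rule card_row_segment)
  qed (use assms(2) \<open>j < n\<close> in simp_all)
  then show False
    using weight_row_return_less_column[OF \<open>2 \<le> j\<close> \<open>j < n\<close> j_le] unfolding S by simp
qed

lemma column_before_next_column: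
  assumes c_less: "Suc c < n" and columns: "{..<c} \<times> {..<n} \<subseteq> underS r (c, 0)"
    and start: "((0, 1), (1, 0)) \<in> r"
  shows "((c, n - 1), (Suc c, 0)) \<in> r"
proof -
  let ?S = "underS r (Suc c, 0)"
  have "underS r (c, 0) \<subseteq> ?S"
    using c_less by (intro underS_mono) auto
  then have "{..<c} \<times> {..<n} \<subseteq> ?S" using columns by blast
  then obtain k where k_le: "k \<le> n" and S: "?S = column_segment n c k"
    using lower_set_eq_column_segmentE[OF lower_set_underS underS_subset] underS_notIn by metis
  have "((c, 1), (Suc c, 0)) \<in> r"
    using second_before_next_column[OF _ c_less columns] start by (cases "c = 0") auto
  then have "(c, 1) \<in> ?S" by (simp add: underS_def)
  then have "2 \<le> k" unfolding S by (auto simp: column_segment_def)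
  have "k = n"
  proof (rule ccontr)
    assume "k \<noteq> n"
    then have "k < n" using k_le by simp
    have "weight d (column_segment n c (Suc k)) \<le> weight d (insert (Suc c, 0) ?S)"
      by (rule weight_column_segment_le)
        (use c_less \<open>k < n\<close> in \<open>simp_all add: S card_column_segment\<close>)
    moreover have "(c, k) \<notin> ?S" "(Suc c, 0) \<notin> ?S" unfolding S by (auto simp: column_segment_def)
    ultimately have "d c + d k \<le> d (Suc c) + d 0"
      by (simp add: S column_segment_Suc weight_insert)
    then show False
      using increment_Suc[OF c_less] increment_0 increment_ge_2[OF \<open>2 \<le> k\<close> \<open>k < n\<close>] c_less by simp
  qed
  then have "(c, n - 1) \<in> ?S" using S c_less by (simp add: column_segment_def)
  then show ?thesis by (simp add: underS_def)
qed

lemma columns_subset_underS: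
  assumes start: "((0, 1), (1, 0)) \<in> r"
  shows "c < n \<Longrightarrow> {..<c} \<times> {..<n} \<subseteq> underS r (c, 0)"
proof (induction c)
  case (Suc c)
  then have columns: "{..<c} \<times> {..<n} \<subseteq> underS r (c, 0)" by simp
  have "underS r (c, 0) \<subseteq> underS r (Suc c, 0)"
    using Suc.prems by (intro underS_mono) auto
  moreover have "(c, y) \<in> underS r (Suc c, 0)" if "y < n" for y
  proof -
    have "((c, y), (c, n - 1)) \<in> r"
      using that Suc.prems by (intro componentwise_le_imp_mem) auto
    moreover have "((c, n - 1), (Suc c, 0)) \<in> r"
      using column_before_next_column[OF Suc.prems columns start] .
    ultimately show ?thesis using trans_order by (auto simp: underS_def dest: transD)
  qed
  ultimately show ?case using columns by (fastforce simp: less_Suc_eq)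
qed simp

lemma eq_lex_order:
  assumes start: "1 < n \<Longrightarrow> ((0, 1), (1, 0)) \<in> r"
  shows "r = lex_order {..<n} id"
proof (rule linear_order_on_eqI[OF linear])
  show "lex_order {..<n} id \<subseteq> r"
  proof clarify
    fix x y x' y' assume "((x, y), (x', y')) \<in> lex_order {..<n} id"
    then have grid: "x < n" "y < n" "x' < n" "y' < n" and lex: "x < x' \<or> x = x' \<and> y \<le> y'"
      by (auto simp: lex_order_def)
    from lex show "((x, y), (x', y')) \<in> r"
    proof (elim disjE conjE)
      assume "x < x'"
      then have "((x, y), (x', 0)) \<in> r"
        using columns_subset_underS[OF start, of x'] grid by (auto simp: underS_def)
      moreover have "((x', 0), (x', y')) \<in> r"
        using grid by (intro componentwise_le_imp_mem) auto
      ultimately show ?thesis using trans_order by (blast dest: transD)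
    next
      assume "x = x'" "y \<le> y'"
      then show ?thesis using grid by (auto intro: componentwise_le_imp_mem)
    qed
  qed
qed (auto simp: lex_order_def)

lemma weight_optimal_order_swap: "weight_optimal_order n d (dir_image r prod.swap)"
proof
  show "linear_order_on grid (dir_image r prod.swap)"
    using linear_order_on_dir_image[OF linear, of prod.swap] by (simp add: product_swap)
next
  fix S assume "ofilter (dir_image r prod.swap) S"
  then obtain S' where preimage: "ofilter r S'" "S = prod.swap ` S'" by (rule ofilter_dir_imageE)
  then show "lower_set S" by (simp add: lower_set_swap ofilter_lower)
  fix T assume "T \<subseteq> grid" "lower_set T" "card T = card S"
  then have "weight d (prod.swap ` T) \<le> weight d S'"
    by (intro ofilter_weight_max) (use preimage in \<open>auto simp: lower_set_swap card_image\<close>)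
  then show "weight d T \<le> weight d S" by (simp add: preimage(2) weight_swap)
qed

lemma eq_lex_or_colex_order: "r = lex_order {..<n} id \<or> r = colex_order {..<n} id"
proof (cases "1 < n \<longrightarrow> ((0, 1), (1, 0)) \<in> r")
  case False
  then have "((1, 0), (0, 1)) \<in> r"
    using mem_underS_iff[of "(0, 1)" "(1, 0)"] by (simp add: underS_def)
  then have "((0, 1), (1, 0)) \<in> dir_image r prod.swap"
    using dir_imageI[of "(1, 0)" "(0, 1)" r prod.swap] by simp
  then have "dir_image r prod.swap = lex_order {..<n} id"
    by (intro weight_optimal_order.eq_lex_order[OF weight_optimal_order_swap])
  then show ?thesis by (metis colex_order_eq_dir_image_swap dir_image_swap_swap)
qed (simp add: eq_lex_order)

end

section \<open>Increments of an optimally labeled graph\<close>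

lemma monotonic_segments_nth_cases:
  assumes "i < length xs"
  obtains (first) "sorted_wrt (<) (take (Suc i) xs)"
    | (later) s where "s \<in> set (tl (monotonic_segments xs))" "hd s \<le> xs ! i"
proof -
  obtain x xs' where "xs = x # xs'" using assms by (cases xs) auto
  then obtain s segs where segs: "monotonic_segments xs = s # segs"
    using monotonic_segments_Cons by blast
  have xs_split: "xs = s @ concat segs"
    using concat_monotonic_segments[of xs] segs by simp
  show thesis
  proof (cases "i < length s")
    case True
    have "sorted_wrt (<) s" using monotonic_segments_increasing[of s xs] segs by simp
    then have "sorted_wrt (<) (take (Suc i) s)" by (rule sorted_wrt_take)
    then show thesis using True first by (simp add: xs_split)
  next
    case False
    then have "xs ! i = concat segs ! (i - length s)" by (simp add: xs_split nth_append)
    moreover have "i - length s < length (concat segs)"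
      using False arg_cong[OF xs_split, of length] assms by simp
    ultimately have "xs ! i \<in> set (concat segs)" by (metis nth_mem)
    then obtain t where segment: "t \<in> set segs" "xs ! i \<in> set t" by auto
    then have "sorted_wrt (<) t"
      using monotonic_segments_increasing[of t xs] segs by simp
    then have "hd t \<le> xs ! i" using segment(2) by (cases t) auto
    then show thesis using segment(1) segs later by simp
  qed
qed

lemma sorted_wrt_less_int_nth:
  fixes xs :: "int list"
  assumes "sorted_wrt (<) xs" "i < length xs"
  shows "xs ! 0 + int i \<le> xs ! i"
  using assms(2)
proof (induction i)
  case (Suc i)
  then have "xs ! i < xs ! Suc i" using sorted_wrt_nth_less[OF assms(1)] by blast
  then show ?case using Suc by simp
qed simp

lemma simple_graph_edgeD:
  assumes "simple_graph V E" "{u, v} \<in> E"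
  shows "u \<in> V" "v \<in> V" "u \<noteq> v"
  using assms unfolding simple_graph_def by (auto simp: doubleton_eq_iff dest!: subsetD)

lemma max_induced_upper:
  assumes "simple_graph V E" "A \<subseteq> V"
  shows "card (induced_edges E A) \<le> max_induced V E (card A)"
  unfolding max_induced_def
proof (rule Max_ge)
  have "finite ((\<lambda>B. card (induced_edges E B)) ` Pow V)"
    using assms(1) by (simp add: simple_graph_def)
  then show "finite {card (induced_edges E B) |B. B \<subseteq> V \<and> card B = card A}"
    by (rule rev_finite_subset) blast
qed (use assms(2) in blast)

lemma max_induced_0:
  assumes "simple_graph V E"
  shows "max_induced V E 0 = 0"
proof -
  have "induced_edges E {} = {}" using assms by (auto simp: simple_graph_def induced_edges_def)
  moreover have "A \<subseteq> V \<and> card A = 0 \<longleftrightarrow> A = {}" for A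
    using assms by (auto simp: simple_graph_def dest: finite_subset)
  ultimately show ?thesis by (simp add: max_induced_def)
qed

lemma sum_delta:
  assumes "simple_graph V E"
  shows "(\<Sum>j<m. delta V E (Suc j)) = int (max_induced V E m)"
  using sum_lessThan_telescope[of "\<lambda>j. int (max_induced V E j)" m]
  by (simp add: delta_def max_induced_0[OF assms])

definition back_neighbours :: "'a set set \<Rightarrow> ('a \<Rightarrow> 'b::linorder) \<Rightarrow> 'a set \<Rightarrow> 'a \<Rightarrow> 'a set" where
  "back_neighbours E h A v = {u \<in> A. {u, v} \<in> E \<and> h u < h v}"

lemma card_induced_edges_eq_sum_back_neighbours:
  assumes "simple_graph V E" "finite A" and proper: "\<And>u v. {u, v} \<in> E \<Longrightarrow> h u \<noteq> h v"
  shows "card (induced_edges E A) = (\<Sum>v\<in>A. card (back_neighbours E h A v))"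
proof -
  let ?star = "\<lambda>v. (\<lambda>u. {u, v}) ` back_neighbours E h A v"
  have "induced_edges E A = (\<Union>v\<in>A. ?star v)"
  proof
    have star: "{u, v} \<in> (\<Union>v\<in>A. ?star v)" if "u \<in> A" "v \<in> A" "{u, v} \<in> E" "h u < h v" for u v
    proof (rule UN_I)
      have "u \<in> back_neighbours E h A v" using that by (simp add: back_neighbours_def)
      then show "{u, v} \<in> ?star v" by (rule imageI)
    qed fact
    show "induced_edges E A \<subseteq> (\<Union>v\<in>A. ?star v)"
    proof
      fix e assume edge: "e \<in> induced_edges E A"
      then obtain u v where e_eq: "e = {u, v}"
        using assms(1) by (auto simp: simple_graph_def induced_edges_def)
      then have ends: "u \<in> A" "v \<in> A" "{u, v} \<in> E" "{v, u} \<in> E"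
        using edge by (auto simp: induced_edges_def insert_commute)
      then consider "h u < h v" | "h v < h u" using proper by (meson linorder_neqE)
      then show "e \<in> (\<Union>v\<in>A. ?star v)"
        using star[of u v] star[of v u] ends unfolding e_eq insert_commute[of v u] by cases simp_all
    qed
  qed (auto simp: back_neighbours_def induced_edges_def)
  also have "card \<dots> = (\<Sum>v\<in>A. card (?star v))"
    using assms(2)
    by (intro card_UN_disjoint) (auto simp: back_neighbours_def doubleton_eq_iff)
  also have "\<dots> = (\<Sum>v\<in>A. card (back_neighbours E h A v))"
    by (intro sum.cong refl card_image) (auto simp: inj_on_def doubleton_eq_iff)
  finally show ?thesis .
qed

locale labeled_graph =
  fixes V :: "'a set" and E :: "'a set set" and lab :: "'a \<Rightarrow> nat"
  assumes simple: "simple_graph V E" and labeling: "optimal_labeling V E lab"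
begin

abbreviation "n \<equiv> card V"
abbreviation "prefix k \<equiv> {v \<in> V. lab v < k}"
abbreviation "back \<equiv> back_neighbours E lab"

abbreviation increment (\<open>\<delta>\<close>) where
  "\<delta> j \<equiv> delta V E (Suc j)"

lemma finite_V [simp]: "finite V"
  using simple by (simp add: simple_graph_def)

lemma bij_lab: "bij_betw lab V {..<n}"
  using labeling by (simp add: optimal_labeling_def lessThan_atLeast0)

lemmas inj_on_lab = bij_betw_imp_inj_on[OF bij_lab]
  and lab_eq_iff = inj_on_eq_iff[OF bij_betw_imp_inj_on[OF bij_lab]]
  and image_lab = bij_betw_imp_surj_on[OF bij_lab]

lemma lab_less: "v \<in> V \<Longrightarrow> lab v < n"
  using bij_betw_apply[OF bij_lab] by simp

lemma lab_surjE:
  assumes "j < n"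
  obtains v where "v \<in> V" "lab v = j"
proof -
  have "j \<in> lab ` V" using assms by (simp add: image_lab)
  then show thesis using that by blast
qed

lemma sum_lab:
  assumes "J \<subseteq> {..<n}"
  shows "(\<Sum>v\<in>{v \<in> V. lab v \<in> J}. g (lab v)) = sum g J"
proof -
  have "lab ` {v \<in> V. lab v \<in> J} = lab ` V \<inter> J" by blast
  then have "lab ` {v \<in> V. lab v \<in> J} = J" using assms by (simp add: image_lab Int_absorb1)
  moreover have "inj_on lab {v \<in> V. lab v \<in> J}"
    by (rule inj_on_subset[OF inj_on_lab]) blast
  ultimately show ?thesis using sum.reindex[of lab "{v \<in> V. lab v \<in> J}" g] by simp
qed

lemma card_lab:
  assumes "J \<subseteq> {..<n}"
  shows "card {v \<in> V. lab v \<in> J} = card J"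
  using sum_lab[OF assms, of "\<lambda>_. 1::nat"] by simp

lemma card_prefix: "k \<le> n \<Longrightarrow> card (prefix k) = k"
  using card_lab[of "{..<k}"] by simp

lemma card_induced_edges_prefix: "k \<le> n \<Longrightarrow> card (induced_edges E (prefix k)) = max_induced V E k"
  using labeling card_prefix[of k] by (simp add: optimal_labeling_def optimal_set_def)

lemma card_induced_edges_eq_sum_back:
  assumes "A \<subseteq> V"
  shows "card (induced_edges E A) = (\<Sum>v\<in>A. card (back A v))"
proof (rule card_induced_edges_eq_sum_back_neighbours[OF simple])
  show "finite A" using assms finite_V by (rule finite_subset)
  show "lab u \<noteq> lab v" if "{u, v} \<in> E" for u v
    using simple_graph_edgeD[OF simple that] by (simp add: lab_eq_iff)
qed

lemma card_induced_edges_insert_last: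
  assumes "A \<subseteq> V" "v \<in> V" "\<And>u. u \<in> A \<Longrightarrow> lab u < lab v"
  shows "card (induced_edges E (insert v A)) = card (induced_edges E A) + card (back A v)"
proof -
  have "finite A" using assms(1) finite_V by (rule finite_subset)
  moreover have "v \<notin> A" using assms(3)[of v] by blast
  moreover have "back (insert v A) u = back A u" if "u \<in> insert v A" for u
    using that assms(3) by (auto simp: back_neighbours_def dest: less_asym)
  ultimately show ?thesis
    using assms by (simp add: card_induced_edges_eq_sum_back)
qed

lemma increment_lab:
  assumes "v \<in> V"
  shows "\<delta> (lab v) = int (card (back V v))"
proof -
  have "max_induced V E (Suc (lab v)) = card (induced_edges E (prefix (Suc (lab v))))"
    using card_induced_edges_prefix[of "Suc (lab v)"] lab_less[OF assms] by simp
  also have "prefix (Suc (lab v)) = insert v (prefix (lab v))"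
    using assms by (auto simp: less_Suc_eq lab_eq_iff)
  also have "card (induced_edges E \<dots>) =
      card (induced_edges E (prefix (lab v))) + card (back (prefix (lab v)) v)"
    by (rule card_induced_edges_insert_last) (use assms in auto)
  also have "back (prefix (lab v)) v = back V v"
    by (auto simp: back_neighbours_def)
  also have "card (induced_edges E (prefix (lab v))) = max_induced V E (lab v)"
    using lab_less[OF assms] by (intro card_induced_edges_prefix) simp
  finally show ?thesis by (simp add: delta_def)
qed

lemma increment_bounds:
  assumes "j < n"
  shows "0 \<le> \<delta> j" "\<delta> j \<le> int j"
proof -
  obtain v where vertex: "v \<in> V" "lab v = j" using lab_surjE assms by blast
  have "back V v \<subseteq> prefix j" using vertex by (auto simp: back_neighbours_def)
  then have "card (back V v) \<le> j"
    using card_mono[of "prefix j" "back V v"] card_prefix[of j] assms by simp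
  then show "0 \<le> \<delta> j" "\<delta> j \<le> int j" using increment_lab[OF vertex(1)] vertex(2) by simp_all
qed

lemma card_back_prefix_le:
  assumes "v \<in> V" "c \<le> lab v"
  shows "int (card (back (prefix c) v)) \<le> \<delta> c"
proof -
  have c_less: "c < n" using assms lab_less[of v] by simp
  have "card (insert v (prefix c)) = Suc c" using assms c_less by (simp add: card_prefix)
  then have "card (induced_edges E (insert v (prefix c))) \<le> max_induced V E (Suc c)"
    using max_induced_upper[OF simple, of "insert v (prefix c)"] assms by auto
  moreover have "card (induced_edges E (insert v (prefix c))) =
      max_induced V E c + card (back (prefix c) v)"
    using card_induced_edges_insert_last[of "prefix c" v] card_induced_edges_prefix[of c] assms c_less
    by auto
  ultimately show ?thesis by (simp add: delta_def)
qed

lemma sum_increment_shift_le: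
  assumes "c + m \<le> n"
  shows "(\<Sum>j<m. \<delta> (c + j)) \<le> int m * \<delta> c + (\<Sum>j<m. \<delta> j)"
proof -
  let ?D = "{v \<in> V. lab v \<in> {c..<c + m}}"
  have interval: "{c..<c + m} \<subseteq> {..<n}" using assms by auto
  have card_D: "card ?D = m" using card_lab[OF interval] by simp
  have "(\<Sum>j<m. \<delta> (c + j)) = sum \<delta> {c..<c + m}"
    by (simp add: sum.atLeastLessThan_shift_0[of \<delta> c] atLeast0LessThan)
  also have "\<dots> = (\<Sum>v\<in>?D. \<delta> (lab v))"
    by (rule sum_lab[OF interval, symmetric])
  also have "\<dots> \<le> (\<Sum>v\<in>?D. \<delta> c + int (card (back ?D v)))"
  proof (rule sum_mono)
    fix v assume v_mem: "v \<in> ?D"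
    then have "back V v = back (prefix c) v \<union> back ?D v"
      by (auto simp: back_neighbours_def)
    then have "card (back V v) \<le> card (back (prefix c) v) + card (back ?D v)"
      by (simp only: card_Un_le)
    then show "\<delta> (lab v) \<le> \<delta> c + int (card (back ?D v))"
      using v_mem increment_lab[of v] card_back_prefix_le[of v c] by simp
  qed
  also have "\<dots> = int m * \<delta> c + int (card (induced_edges E ?D))"
    using card_D card_induced_edges_eq_sum_back[of ?D] by (simp add: sum.distrib)
  also have "\<dots> \<le> int m * \<delta> c + (\<Sum>j<m. \<delta> j)"
    using max_induced_upper[OF simple, of ?D] card_D by (simp add: sum_delta[OF simple])
  finally show ?thesis .
qed

lemma increment_ge_2:
  assumes "delta_dense V E" "2 \<le> j" "j < n"
  shows "2 \<le> \<delta> j"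
proof -
  have nth: "delta_seq V E ! i = \<delta> i" if "i < n" for i
    using that by (simp add: delta_seq_def del: upt_Suc)
  have length: "j < length (delta_seq V E)" using assms(3) by (simp add: delta_seq_def)
  then show ?thesis
  proof (cases rule: monotonic_segments_nth_cases)
    case first
    then have "\<delta> 0 + int j \<le> \<delta> j"
      using sorted_wrt_less_int_nth[OF first, of j] length nth[of 0] nth[of j] assms(3) by simp
    moreover have "0 \<le> \<delta> 0" using assms(3) by (intro increment_bounds) simp
    ultimately show ?thesis using assms(2) by simp
  next
    case later
    then show ?thesis using assms(1,3) nth[of j] by (fastforce simp: delta_dense_def)
  qed
qed

lemma dense_increments_delta: "delta_dense V E \<Longrightarrow> dense_increments n \<delta>"
  using increment_bounds[of 0] increment_bounds[of 1] increment_ge_2 sum_increment_shift_le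
  by unfold_locales auto

end

section \<open>Compressed sets in the square\<close>

lemma square_edges_iff:
  assumes "a \<in> V" "b \<in> V" "u \<in> V" "v \<in> V"
  shows "{(a, b), (u, v)} \<in> square_edges V E \<longleftrightarrow> a = u \<and> {b, v} \<in> E \<or> {a, u} \<in> E \<and> b = v"
proof
  assume "{(a, b), (u, v)} \<in> square_edges V E"
  then obtain x y x' y' where same_edge: "{(a, b), (u, v)} = {(x, y), (x', y')}"
    and adj: "x = x' \<and> {y, y'} \<in> E \<or> {x, x'} \<in> E \<and> y = y'"
    unfolding square_edges_def by blast
  from same_edge consider "a = x" "b = y" "u = x'" "v = y'" | "a = x'" "b = y'" "u = x" "v = y"
    by (auto simp: doubleton_eq_iff)
  then show "a = u \<and> {b, v} \<in> E \<or> {a, u} \<in> E \<and> b = v"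
    using adj by cases (simp_all add: insert_commute eq_commute)
next
  assume "a = u \<and> {b, v} \<in> E \<or> {a, u} \<in> E \<and> b = v"
  then show "{(a, b), (u, v)} \<in> square_edges V E"
    using assms unfolding square_edges_def by blast
qed

lemma simple_graph_square:
  assumes "simple_graph V E"
  shows "simple_graph (V \<times> V) (square_edges V E)"
  unfolding simple_graph_def
proof
  show "finite (V \<times> V)" using assms by (simp add: simple_graph_def)
  show "square_edges V E \<subseteq> {{p, q} |p q. p \<in> V \<times> V \<and> q \<in> V \<times> V \<and> p \<noteq> q}"
  proof
    fix e assume "e \<in> square_edges V E"
    then obtain x y u v where endpoints: "e = {(x, y), (u, v)}" "x \<in> V" "y \<in> V" "u \<in> V" "v \<in> V"
      and adj: "x = u \<and> {y, v} \<in> E \<or> {x, u} \<in> E \<and> y = v"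
      unfolding square_edges_def by blast
    have "(x, y) \<noteq> (u, v)"
      using adj simple_graph_edgeD(3)[OF assms] by auto
    then show "e \<in> {{p, q} |p q. p \<in> V \<times> V \<and> q \<in> V \<times> V \<and> p \<noteq> q}"
      using endpoints by blast
  qed
qed

context labeled_graph
begin

abbreviation lab_pair :: "'a \<times> 'a \<Rightarrow> nat \<times> nat" where
  "lab_pair \<equiv> map_prod lab lab"

lemma inj_on_lab_pair: "inj_on lab_pair (V \<times> V)"
  using inj_on_lab by (rule map_prod_inj_on) (rule inj_on_lab)

lemma image_lab_pair: "lab_pair ` (V \<times> V) = {..<n} \<times> {..<n}"
  by (simp add: map_prod_surj_on[OF image_lab image_lab])

lemma lab_pair_mem_image:
  "S \<subseteq> V \<times> V \<Longrightarrow> u \<in> V \<Longrightarrow> v \<in> V \<Longrightarrow> (lab u, lab v) \<in> lab_pair ` S \<longleftrightarrow> (u, v) \<in> S"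
  using inj_on_image_mem_iff[OF inj_on_lab_pair, of "(u, v)" S] by simp

lemma lower_set_compressed:
  assumes "compressed V lab S"
  shows "lower_set (lab_pair ` S)"
  unfolding lower_set_def
proof (intro allI impI)
  fix x y x' y' assume "(x, y) \<in> lab_pair ` S" and smaller: "x' \<le> x" "y' \<le> y"
  then obtain u v where point: "(u, v) \<in> S" "lab u = x" "lab v = y" by auto
  have "u \<in> V" using assms point(1) by (auto simp: compressed_def)
  then obtain k where "lab ` {b. (u, b) \<in> S} = {0..<k}"
    using assms unfolding compressed_def by blast
  moreover from this have "lab v < k" using point(1) by force
  ultimately have "y' \<in> lab ` {b. (u, b) \<in> S}" using smaller(2) point(3) by simp
  then obtain b where lowered: "(u, b) \<in> S" "lab b = y'" by blast
  have "b \<in> V" using assms lowered(1) by (auto simp: compressed_def)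
  then obtain l where "lab ` {a. (a, b) \<in> S} = {0..<l}"
    using assms unfolding compressed_def by blast
  moreover from this have "lab u < l" using lowered(1) by force
  ultimately have "x' \<in> lab ` {a. (a, b) \<in> S}" using smaller(1) point(2) by simp
  then show "(x', y') \<in> lab_pair ` S" using lowered(2) by force
qed

lemma back_neighbours_square:
  assumes "S \<subseteq> V \<times> V" "lower_set (lab_pair ` S)" "(u, v) \<in> S"
  shows "back_neighbours (square_edges V E) (\<lambda>(a, b). lab a + lab b) S (u, v) =
    back V u \<times> {v} \<union> {u} \<times> back V v"
proof (rule set_eqI, clarify)
  fix a b
  have point: "u \<in> V" "v \<in> V" using assms(1,3) by auto
  show "(a, b) \<in> back_neighbours (square_edges V E) (\<lambda>(a, b). lab a + lab b) S (u, v) \<longleftrightarrow>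
      (a, b) \<in> back V u \<times> {v} \<union> {u} \<times> back V v"
  proof (cases "a \<in> V \<and> b \<in> V")
    case True
    then have "(a, b) \<in> S" if "lab a \<le> lab u" "lab b \<le> lab v"
      using lower_setD[OF assms(2), of "lab u" "lab v" "lab a" "lab b"] that assms(1,3) point
      by (simp add: lab_pair_mem_image)
    then show ?thesis using True point by (auto simp: back_neighbours_def square_edges_iff)
  next
    case False
    then show ?thesis using assms(1) point by (auto simp: back_neighbours_def)
  qed
qed

lemma card_induced_square_edges_eq_weight:
  assumes "S \<subseteq> V \<times> V" "lower_set (lab_pair ` S)"
  shows "int (card (induced_edges (square_edges V E) S)) = weight \<delta> (lab_pair ` S)"
proof -
  let ?h = "\<lambda>(a, b). lab a + lab b"
  have "finite S" using assms(1) by (rule finite_subset) simp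
  then have "card (induced_edges (square_edges V E) S) =
      (\<Sum>p\<in>S. card (back_neighbours (square_edges V E) ?h S p))"
  proof (rule card_induced_edges_eq_sum_back_neighbours[OF simple_graph_square[OF simple]])
    fix p q assume edge: "{p, q} \<in> square_edges V E"
    obtain a b u v where coordinates: "p = (a, b)" "q = (u, v)" by fastforce
    have "a \<in> V" "b \<in> V" "u \<in> V" "v \<in> V"
      using simple_graph_edgeD[OF simple_graph_square[OF simple] edge] coordinates by auto
    then show "?h p \<noteq> ?h q"
      using edge simple_graph_edgeD(3)[OF simple]
      by (auto simp: coordinates square_edges_iff lab_eq_iff)
  qed
  also have "int \<dots> = (\<Sum>(u, v)\<in>S. \<delta> (lab u) + \<delta> (lab v))"
    unfolding of_nat_sum
  proof (intro sum.cong refl, clarify)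
    fix u v assume point: "(u, v) \<in> S"
    have "card (back V u \<times> {v} \<union> {u} \<times> back V v) = card (back V u) + card (back V v)"
      by (subst card_Un_disjoint) (auto simp: card_cartesian_product back_neighbours_def)
    then show "int (card (back_neighbours (square_edges V E) ?h S (u, v))) = \<delta> (lab u) + \<delta> (lab v)"
      using back_neighbours_square[OF assms point] assms(1) point increment_lab by auto
  qed
  also have "\<dots> = weight \<delta> (lab_pair ` S)"
    unfolding weight_def
    by (subst sum.reindex[OF inj_on_subset[OF inj_on_lab_pair assms(1)]])
      (simp add: case_prod_unfold)
  finally show ?thesis .
qed

lemma weight_le_optimal:
  assumes "optimal_set (V \<times> V) (square_edges V E) S" "lower_set (lab_pair ` S)"
    and "T \<subseteq> {..<n} \<times> {..<n}" "lower_set T" "card T = card S"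
  shows "weight \<delta> T \<le> weight \<delta> (lab_pair ` S)"
proof -
  obtain U where preimage: "U \<subseteq> V \<times> V" "inj_on lab_pair U" "T = lab_pair ` U"
    using assms(3) by (auto simp flip: image_lab_pair simp: subset_image_inj)
  have "S \<subseteq> V \<times> V" "card U = card S"
    using assms(1,5) preimage by (simp_all add: optimal_set_def card_image)
  then have "card (induced_edges (square_edges V E) U) \<le> card (induced_edges (square_edges V E) S)"
    using max_induced_upper[OF simple_graph_square[OF simple] preimage(1)] assms(1)
    by (simp add: optimal_set_def)
  then show ?thesis
    using card_induced_square_edges_eq_weight[of U] card_induced_square_edges_eq_weight[of S]
      preimage \<open>S \<subseteq> V \<times> V\<close> assms(2,4) by simp
qed

lemma weight_optimal_order_lab_pair:
  assumes "delta_dense V E" "compressed_optimal_order V E lab r"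
  shows "weight_optimal_order n \<delta> (dir_image r lab_pair)"
proof -
  have linear: "linear_order_on (V \<times> V) r"
    and compressed: "\<And>S. ofilter r S \<Longrightarrow> compressed V lab S"
    and optimal: "\<And>S. ofilter r S \<Longrightarrow> optimal_set (V \<times> V) (square_edges V E) S"
    using assms(2) by (auto simp: compressed_optimal_order_def)
  interpret dense_increments n \<delta> using assms(1) by (rule dense_increments_delta)
  show ?thesis
  proof
    show "linear_order_on ({..<n} \<times> {..<n}) (dir_image r lab_pair)"
      using linear_order_on_dir_image[OF linear inj_on_lab_pair] unfolding image_lab_pair .
  next
    fix S assume "ofilter (dir_image r lab_pair) S"
    then obtain S' where preimage: "ofilter r S'" "S = lab_pair ` S'" by (rule ofilter_dir_imageE)
    show lower: "lower_set S"
      unfolding preimage(2) using compressed[OF preimage(1)] by (rule lower_set_compressed)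
    fix T assume competitor: "T \<subseteq> {..<n} \<times> {..<n}" "lower_set T" "card T = card S"
    have "S' \<subseteq> V \<times> V" using optimal[OF preimage(1)] by (simp add: optimal_set_def)
    then have "card S = card S'"
      unfolding preimage(2) by (intro card_image inj_on_subset[OF inj_on_lab_pair])
    then show "weight \<delta> T \<le> weight \<delta> S"
      using weight_le_optimal[OF optimal[OF preimage(1)]] competitor lower by (simp add: preimage(2))
  qed
qed

end

theorem theorem8:
  fixes V :: "'a set" and E :: "'a set set"
    and lab :: "'a \<Rightarrow> nat" and r :: "('a \<times> 'a) rel"
  assumes "simple_graph V E"
    and "delta_dense V E"
    and "nested_solutions V E"
    and "nested_solutions (V \<times> V) (square_edges V E)"
    and "optimal_labeling V E lab"
    and "compressed_optimal_order V E lab r"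
  shows "r = lex_order V lab \<or> r = colex_order V lab"
proof -
  interpret labeled_graph V E lab
    using assms(1,5) by unfold_locales
  interpret weight_optimal_order n \<delta> "dir_image r lab_pair"
    using assms(2,6) by (rule weight_optimal_order_lab_pair)
  have "r \<subseteq> (V \<times> V) \<times> (V \<times> V)"
    using assms(6) by (simp add: compressed_optimal_order_def order_on_defs)
  moreover have "lex_order V lab \<subseteq> (V \<times> V) \<times> (V \<times> V)" "colex_order V lab \<subseteq> (V \<times> V) \<times> (V \<times> V)"
    by (auto simp: lex_order_def colex_order_def)
  moreover have "dir_image r lab_pair = dir_image (lex_order V lab) lab_pair \<or>
      dir_image r lab_pair = dir_image (colex_order V lab) lab_pair"
    using eq_lex_or_colex_order
    by (simp add: dir_image_lex_order dir_image_colex_order inj_on_lab image_lab)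
  ultimately show ?thesis
    by (simp add: dir_image_eq_iff[OF inj_on_lab_pair])
qed

end
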